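(* Let $n\ge2$. The average output length (over uniformly random $X\in pRo_n$) of the planar rook factorization algorithm described in the context is $$\overline L_n^{pRo}=2n+\frac{2^{2n-3}(n-1)}{\binom{2n}{n}}.$$ With the step count $T(X)=2n+2L(X)$, where $L(X)$ is the length of the word returned for $X$, the average runtime $\operatorname{Avg}_n=\frac1{|pRo_n|}\sum_{X\in pRo_n}T(X)$ is $$\operatorname{Avg}_n=6n+\frac{2^{2n-2}(n-1)}{\binom{2n}{n}}\sim\frac{\sqrt{\pi}}4\cdot n^{3/2}\qquad(n\to\infty).$$
   Context: **Planar rook monoid.** $pRo_n$ consists of the diagrams on top vertices $1,\dots,n$ and bottom vertices $1',\dots,n'$ whose blocks are singletons (dots) or transversal pairs $\{a,c'\}$ and which are planar; equivalently, order-preserving partial bijections of $\{1,\dots,n\}$, under stacking of diagrams. For $1\le i<n$ (all other vertices joined vertically): $l_i$ has the pair $\{i,(i+1)'\}$ and dots $i+1$, $i'$; $r_i$ has the pair $\{i+1,i'\}$ and dots $i$, $(i+1)'$. **Algorithm.** Put $D(i)=r_il_i$ for $i<n$ and $D(n)=l_{n-1}r_{n-1}$. Return the concatenation, in this order, of: $D(i)$ for the top dots $i$; the words $l_al_{a+1}\cdots l_{c-1}$ for the transversal pairs $\{a,c'\}$ with $a<c$, by decreasing $a$; the words $r_{a-1}r_{a-2}\cdots r_c$ for the transversal pairs with $a>c$, by increasing $a$; $D(i)$ for the bottom dots $i'$. Thus, if $X$ has $k$ transversal pairs, $L(X)=4(n-k)+\sum_{\{a,c'\}\in X}|a-c|$.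 $\overline L_n^{pRo}=\frac1{|pRo_n|}\sum_{X\in pRo_n}L(X)$. The symbol $\sim$ means asymptotically equal (ratio tends to $1$). *)

theory Defs
  imports
    Complex_Main
    "HOL-Algebra.Group"
    "HOL-Library.Disjoint_Sets"
    "HOL-Library.Landau_Symbols"
    "HOL-Library.Product_Lexorder"
begin

text \<open>Vertices \<open>a\<close> on top and \<open>c'\<close> at the bottom; a diagram is its set of blocks.\<close>

datatype vertex = Top nat | Bot nat

type_synonym diagram = "vertex set set"

definition vertices :: "nat \<Rightarrow> vertex set" where
  "vertices n = Top ` {1..n} \<union> Bot ` {1..n}"

definition transversals :: "diagram \<Rightarrow> (nat \<times> nat) set" where
  "transversals X = {(a, c). {Top a, Bot c} \<in> X}"

definition top_dots :: "diagram \<Rightarrow> nat set" where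
  "top_dots X = {i. {Top i} \<in> X}"

definition bottom_dots :: "diagram \<Rightarrow> nat set" where
  "bottom_dots X = {i. {Bot i} \<in> X}"

text \<open>With vertices \<open>1, \<dots>, n\<close> placed from left to right in both rows, the only crossings a diagram
  with blocks of this kind can have are between two transversal pairs.\<close>

definition planar :: "diagram \<Rightarrow> bool" where
  "planar X \<longleftrightarrow>
     \<not> (\<exists>a b c d. (a, c) \<in> transversals X \<and> (b, d) \<in> transversals X \<and> a < b \<and> d < c)"

definition planar_rook_diagrams :: "nat \<Rightarrow> diagram set" where
  "planar_rook_diagrams n =
     {X. partition_on (vertices n) X \<and>
         (\<forall>B\<in>X. (\<exists>v. B = {v}) \<or> (\<exists>a c. B = {Top a, Bot c})) \<and>
         planar X}"

text \<open>The diagram with transversal pairs \<open>{a, c'}\<close> for \<open>(a, c) \<in> R\<close> and dots elsewhere.\<close>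

definition diagram_of :: "nat \<Rightarrow> (nat \<times> nat) set \<Rightarrow> diagram" where
  "diagram_of n R =
     (\<lambda>(a, c). {Top a, Bot c}) ` R
     \<union> (\<lambda>a. {Top a}) ` ({1..n} - Domain R)
     \<union> (\<lambda>c. {Bot c}) ` ({1..n} - Range R)"

text \<open>Multiplication is stacking, the first factor on top: \<open>{a, c'}\<close> is a block of the product iff
  \<open>{a, b'}\<close> and \<open>{b, c'}\<close> are blocks of the first and second factor for some \<open>b\<close>.\<close>

definition pRo :: "nat \<Rightarrow> diagram monoid" where
  "pRo n =
     \<lparr> carrier = planar_rook_diagrams n,
       mult = (\<lambda>X Y. diagram_of n (transversals X O transversals Y)),
       one = diagram_of n (Id_on {1..n}) \<rparr>"

definition gen_l :: "nat \<Rightarrow> nat \<Rightarrow> diagram" where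
  "gen_l n i = diagram_of n (insert (i, i + 1) (Id_on ({1..n} - {i, i + 1})))"

definition gen_r :: "nat \<Rightarrow> nat \<Rightarrow> diagram" where
  "gen_r n i = diagram_of n (insert (i + 1, i) (Id_on ({1..n} - {i, i + 1})))"

text \<open>A word over the generators is a list of diagrams.\<close>

definition dot_word :: "nat \<Rightarrow> nat \<Rightarrow> diagram list" where
  "dot_word n i =
     (if i < n then [gen_r n i, gen_l n i] else [gen_l n (n - 1), gen_r n (n - 1)])"

definition l_word :: "nat \<Rightarrow> nat \<Rightarrow> nat \<Rightarrow> diagram list" where
  "l_word n a c = map (gen_l n) [a..<c]"

definition r_word :: "nat \<Rightarrow> nat \<Rightarrow> nat \<Rightarrow> diagram list" where
  "r_word n a c = map (gen_r n) (rev [c..<a])"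

text \<open>Pairs are ordered lexicographically; since no two transversal pairs share a top vertex, this
  orders them by \<open>a\<close>. The dots are processed from left to right.\<close>

definition factorization :: "nat \<Rightarrow> diagram \<Rightarrow> diagram list" where
  "factorization n X =
     concat (map (dot_word n) (sorted_list_of_set (top_dots X)))
     @ concat (map (\<lambda>(a, c). l_word n a c)
         (rev (sorted_list_of_set {(a, c). (a, c) \<in> transversals X \<and> a < c})))
     @ concat (map (\<lambda>(a, c). r_word n a c)
         (sorted_list_of_set {(a, c). (a, c) \<in> transversals X \<and> a > c}))
     @ concat (map (dot_word n) (sorted_list_of_set (bottom_dots X)))"

definition output_length :: "nat \<Rightarrow> diagram \<Rightarrow> nat" where
  "output_length n X = length (factorization n X)"

definition step_count :: "nat \<Rightarrow> diagram \<Rightarrow> nat" where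
  "step_count n X = 2 * n + 2 * output_length n X"

definition average_length :: "nat \<Rightarrow> real" where
  "average_length n =
     (\<Sum>X\<in>carrier (pRo n). real (output_length n X)) / real (card (carrier (pRo n)))"

definition average_runtime :: "nat \<Rightarrow> real" where
  "average_runtime n =
     (\<Sum>X\<in>carrier (pRo n). real (step_count n X)) / real (card (carrier (pRo n)))"

end

theory Submission
  imports Defs "HOL-Real_Asymp.Real_Asymp"
begin

text \<open>
  A diagram is determined by its set \<open>A\<close> of top endpoints and its set \<open>B\<close> of bottom endpoints, where
  \<open>|A| = |B|\<close>; its transversal pairs join elements of equal rank. Replacing \<open>B\<close> by its complement turns
  the pair into an \<open>n\<close>-subset \<open>C\<close> of the \<open>2n\<close> vertices. By planarity, all pairs crossing the vertical
  line behind column \<open>j\<close> do so in the same direction, so the total displacement \<open>\<Sum>|a - c|\<close> equals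
  \<open>\<Sum>\<^sub>j ||C \<inter> V\<^sub>j| - j|\<close>, where \<open>V\<^sub>j\<close> consists of the \<open>2j\<close> vertices in the first \<open>j\<close> columns. Summed over
  \<open>C\<close>, the term for \<open>j\<close> is the mean absolute deviation of a hypergeometric distribution; it telescopes
  to \<open>j (n - j) b\<^sub>j b\<^bsub>n-j\<^esub> / n\<close> with \<open>b\<^sub>k\<close> the central binomial coefficients. Convolving via the recurrence
  \<open>(k + 1) b\<^bsub>k+1\<^esub> = 4 k b\<^sub>k + 2 b\<^sub>k\<close> gives \<open>2\<^bsup>2n-3\<^esup> (n - 1)\<close>. The asymptotics follow from Wallis's bounds
  on \<open>4\<^sup>n / b\<^sub>n\<close>.
\<close>

subsection \<open>Central binomial coefficients\<close>

text \<open>Pascal's rule gives two summands that are equal by symmetry of row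
  \<open>2 * k + 1\<close>; absorption then leads down to row \<open>2 * k\<close>.\<close>

lemma central_binomial_Suc:
  "Suc k * (2 * Suc k choose Suc k) = 2 * (2 * k + 1) * (2 * k choose k)"
proof -
  have "(2 * k + 1 choose k) = (2 * k + 1 choose Suc k)"
    using binomial_symmetric[of k "2 * k + 1"] by simp
  hence "2 * Suc k choose Suc k = 2 * (Suc (2 * k) choose Suc k)"
    by simp
  thus ?thesis
    using Suc_times_binomial[of k "2 * k"] by (simp add: algebra_simps)
qed

definition central_binomial :: "nat \<Rightarrow> real" where
  "central_binomial k = real (2 * k choose k)"

lemma central_binomial_weighted_Suc:
  "real (Suc k) * central_binomial (Suc k)
     = 4 * (real k * central_binomial k) + 2 * central_binomial k"
proof -
  have "real (Suc k * (2 * Suc k choose Suc k)) = real (2 * (2 * k + 1) * (2 * k choose k))"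
    by (simp only: central_binomial_Suc)
  thus ?thesis
    unfolding central_binomial_def of_nat_mult by (simp add: algebra_simps)
qed

text \<open>The term \<open>k = 0\<close> vanishes, so the index shifts by one and the recurrence
  applies to each weighted coefficient. Keeping \<open>g\<close> arbitrary lets this serve both
  convolutions below.\<close>

lemma central_binomial_convolution_Suc:
  "(\<Sum>k\<le>Suc n. real k * central_binomial k * g (Suc n - k))
     = 4 * (\<Sum>k\<le>n. real k * central_binomial k * g (n - k))
       + 2 * (\<Sum>k\<le>n. central_binomial k * g (n - k))"
proof -
  have "(\<Sum>k\<le>Suc n. real k * central_binomial k * g (Suc n - k))
      = (\<Sum>k\<le>n. real (Suc k) * central_binomial (Suc k) * g (n - k))"
    by (subst sum.atMost_Suc_shift) simp
  also have "\<dots> = (\<Sum>k\<le>n. (4 * (real k * central_binomial k) + 2 * central_binomial k) * g (n - k))"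
    by (simp only: central_binomial_weighted_Suc)
  finally show ?thesis
    by (simp add: ring_distribs sum.distrib sum_distrib_left mult.assoc)
qed

lemma sum_reflect: "(\<Sum>k\<le>n. f k (n - k)) = (\<Sum>k\<le>n. f (n - k) k)" for n :: nat
  by (rule sum.reindex_bij_witness[of _ "\<lambda>k. n - k" "\<lambda>k. n - k"]) auto

text \<open>Adding the sum to its reflection replaces the weight \<open>k\<close> by
  \<open>k + (n - k) = n\<close>.\<close>

lemma central_binomial_convolution_weighted:
  "2 * (\<Sum>k\<le>n. real k * central_binomial k * central_binomial (n - k))
     = real n * (\<Sum>k\<le>n. central_binomial k * central_binomial (n - k))"
proof -
  have "(\<Sum>k\<le>n. real k * central_binomial k * central_binomial (n - k))
      = (\<Sum>k\<le>n. real (n - k) * central_binomial k * central_binomial (n - k))"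
    by (subst sum_reflect) (simp add: mult_ac)
  hence "2 * (\<Sum>k\<le>n. real k * central_binomial k * central_binomial (n - k))
      = (\<Sum>k\<le>n. (real k + real (n - k)) * (central_binomial k * central_binomial (n - k)))"
    by (simp add: ring_distribs sum.distrib mult.assoc del: of_nat_diff)
  also have "\<dots> = (\<Sum>k\<le>n. real n * (central_binomial k * central_binomial (n - k)))"
    by (intro sum.cong) auto
  finally show ?thesis by (simp add: sum_distrib_left)
qed

text \<open>Writing s(n) for the sum, the weighted identity and the shift rule combine to (n + 1)
  s(n + 1) = 4 n s(n) + 4 s(n), so each step multiplies by 4.\<close>

lemma central_binomial_convolution:
  "(\<Sum>k\<le>n. central_binomial k * central_binomial (n - k)) = 4 ^ n"
proof (induction n)
  case 0
  show ?case by (simp add: central_binomial_def)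
next
  case (Suc n)
  have "real (Suc n) * (\<Sum>k\<le>Suc n. central_binomial k * central_binomial (Suc n - k))
      = 4 * (2 * (\<Sum>k\<le>n. real k * central_binomial k * central_binomial (n - k)))
        + 4 * (\<Sum>k\<le>n. central_binomial k * central_binomial (n - k))"
    unfolding central_binomial_convolution_weighted[symmetric] central_binomial_convolution_Suc by simp
  also have "\<dots> = real (Suc n) * 4 ^ Suc n"
    unfolding central_binomial_convolution_weighted Suc.IH by (simp add: algebra_simps)
  finally show ?case by (metis mult_left_cancel of_nat_eq_0_iff nat.distinct(1))
qed

text \<open>With D(n) for the sum, the shift rule gives D(n + 1) = 4 D(n) + n 4^n; the last term is
  twice the convolution weighted on one side.\<close>

lemma central_binomial_convolution_weighted_both:
  "(\<Sum>k\<le>n. real k * central_binomial k * (real (n - k) * central_binomial (n - k)))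
     = real n * (real n - 1) * 4 ^ n / 8"
proof (induction n)
  case 0
  show ?case by simp
next
  case (Suc n)
  have "(\<Sum>k\<le>n. central_binomial k * (real (n - k) * central_binomial (n - k)))
      = (\<Sum>k\<le>n. real k * central_binomial k * central_binomial (n - k))"
    by (subst sum_reflect) (simp add: mult_ac)
  also have "\<dots> = real n * 4 ^ n / 2"
    using central_binomial_convolution_weighted[of n]
    by (simp add: central_binomial_convolution)
  finally have *: "(\<Sum>k\<le>n. central_binomial k * (real (n - k) * central_binomial (n - k)))
      = real n * 4 ^ n / 2" .
  show ?case
    unfolding central_binomial_convolution_Suc[where g = "\<lambda>m. real m * central_binomial m"] Suc.IH *
    by (simp add: field_simps)
qed

subsection \<open>Hypergeometric sums\<close>

lemma Suc_times_binomial_Suc: "real (Suc k) * real (n choose Suc k) = (real n - real k) * real (n choose k)"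
proof (cases "k \<le> n")
  case True
  have "real (Suc k * (n choose Suc k)) = real ((n - k) * (n choose k))"
    by (metis binomial_absorb_comp binomial_absorption mult.commute) 
  then show ?thesis using True by (simp only: of_nat_mult of_nat_diff)
next
  case False
  then show ?thesis by (simp add: binomial_eq_0)
qed

text \<open>The first factor is \<open>p + q\<close> times the deviation of the mean
  \<open>p * r / (p + q)\<close> from \<open>e\<close>. The sum telescopes: each summand is the
  difference of two consecutive values of the right-hand side.\<close>

lemma hypergeometric_partial_sum:
  assumes "k \<le> r"
  shows "(\<Sum>e<k. (real p * real r - (real p + real q) * real e) * (real (p choose e) * real (q choose (r - e))))
     = real k * (real q - real r + real k) * (real (p choose k) * real (q choose (r - k)))"
  using assms
proof (induction k)
  case 0
  show ?case by simp
next
  case (Suc k)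
  define x y where "x = real (p choose k)" and "y = real (q choose (r - Suc k))"
  have p: "real (Suc k) * real (p choose Suc k) = (real p - real k) * x"
    unfolding x_def by (rule Suc_times_binomial_Suc)
  have "r - k = Suc (r - Suc k)" using Suc.prems by simp
  hence "(real r - real k) * real (q choose (r - k)) = (real q - (real r - real (Suc k))) * y"
    using Suc_times_binomial_Suc[of "r - Suc k" q] Suc.prems by (simp add: y_def)
  hence q: "(real q - real r + real (Suc k)) * y = (real r - real k) * real (q choose (r - k))"
    by (simp add: algebra_simps)
  have "real (Suc k) * (real q - real r + real (Suc k)) * (real (p choose Suc k) * y)
      = (real (Suc k) * real (p choose Suc k)) * ((real q - real r + real (Suc k)) * y)"
    by (simp only: mult_ac)
  also have "\<dots> = (real p - real k) * (real r - real k) * (x * real (q choose (r - k)))"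
    unfolding p q by (simp only: mult_ac)
  finally have *: "real (Suc k) * (real q - real r + real (Suc k)) * (real (p choose Suc k) * y)
      = (real p - real k) * (real r - real k) * (x * real (q choose (r - k)))" .
  have IH: "(\<Sum>e<k. (real p * real r - (real p + real q) * real e) * (real (p choose e) * real (q choose (r - e))))
     = real k * (real q - real r + real k) * (x * real (q choose (r - k)))"
    using Suc by (simp add: x_def)
  \<comment> \<open>All terms are now multiples of \<open>x * real (q choose (r - k))\<close>, and
    what remains is
    \<open>p * r - (p + q) * k + k * (q - r + k) = (p - k) * (r - k)\<close>.\<close>
  show ?case
    unfolding sum.lessThan_Suc IH *[unfolded y_def] x_def[symmetric] by algebra
qed

text \<open>The summand \<open>e = r\<close> is the negative of the partial sum below
  \<open>r\<close>: both are \<open>r * q * (p choose r)\<close> up to sign.\<close>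

lemma hypergeometric_centred_sum:
  "(\<Sum>e\<le>r. (real p * real r - (real p + real q) * real e) * (real (p choose e) * real (q choose (r - e)))) = 0"
  unfolding lessThan_Suc_atMost[symmetric] sum.lessThan_Suc hypergeometric_partial_sum[OF order_refl]
  by (simp add: algebra_simps)

text \<open>Signed deviations from the mean cancel in total, so the absolute deviations sum to twice
  the part below the mean, which the telescoped formula evaluates.\<close>

lemma hypergeometric_central_moment:
  assumes "j \<le> n" "n > 0"
  shows "(\<Sum>e\<le>n. \<bar>real e - real j\<bar> * (real (2 * j choose e) * real (2 * (n - j) choose (n - e))))
     = real j * central_binomial j * (real (n - j) * central_binomial (n - j)) / real n"
proof -
  define t where "t e = real (2 * j choose e) * real (2 * (n - j) choose (n - e))" for e
  \<comment> \<open>For \<open>p = 2 * j\<close>, \<open>q = 2 * (n - j)\<close> and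
    \<open>r = n\<close> the mean is exactly \<open>j\<close>.\<close>
  have coeff: "real (2 * j) * real n - (real (2 * j) + real (2 * (n - j))) * real e
      = 2 * real n * (real j - real e)" for e
    using assms by (simp add: of_nat_diff algebra_simps)
  have total: "(\<Sum>e\<le>n. (real j - real e) * t e) = 0"
    using hypergeometric_centred_sum[of "2 * j" n "2 * (n - j)"] assms
    unfolding coeff t_def[symmetric] mult.assoc sum_distrib_left[symmetric] by simp
  \<comment> \<open>At \<open>k = j\<close> the factor \<open>q - r + k\<close> equals
    \<open>n - j\<close> and both binomials become central.\<close>
  have part: "2 * real n * (\<Sum>e<j. (real j - real e) * t e)
      = real j * (real (n - j) * (central_binomial j * central_binomial (n - j)))"
    using hypergeometric_partial_sum[OF assms(1), of "2 * j" "2 * (n - j)"] assms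
    unfolding coeff t_def[symmetric] mult.assoc sum_distrib_left[symmetric]
    by (simp add: of_nat_diff t_def central_binomial_def)
  have "(\<Sum>e\<le>n. \<bar>real e - real j\<bar> * t e)
      = (\<Sum>e\<le>n. (if e < j then 2 * ((real j - real e) * t e) else 0) - (real j - real e) * t e)"
    by (intro sum.cong) (auto simp: algebra_simps)
  also have "\<dots> = (\<Sum>e\<le>n. if e < j then 2 * ((real j - real e) * t e) else 0)"
    by (simp add: sum_subtractf total)
  also have "\<dots> = (\<Sum>e<j. 2 * ((real j - real e) * t e))"
    using assms by (subst sum.inter_filter[symmetric]) (auto intro!: sum.cong)
  also have "\<dots> = 2 * (\<Sum>e<j. (real j - real e) * t e)"
    by (simp only: sum_distrib_left)
  also have "\<dots> = real j * central_binomial j * (real (n - j) * central_binomial (n - j)) / real n"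
    using part assms by (simp add: field_simps)
  finally show ?thesis unfolding t_def .
qed

section \<open>Counting subsets by the size of an intersection\<close>

lemma card_subsets_split:
  assumes "finite V" "W \<subseteq> V" "e \<le> r"
  shows "card {C. C \<subseteq> V \<and> card C = r \<and> card (C \<inter> W) = e}
     = (card W choose e) * (card (V - W) choose (r - e))"
proof -
  have fin: "finite W" "finite (V - W)" using assms finite_subset by auto
  have split: "card C = card (C \<inter> W) + card (C - W)" if "C \<subseteq> V" for C
    using that assms(1) by (metis card_Int_Diff finite_subset)
  have "bij_betw (\<lambda>C. (C \<inter> W, C - W)) {C. C \<subseteq> V \<and> card C = r \<and> card (C \<inter> W) = e}
      ({A. A \<subseteq> W \<and> card A = e} \<times> {B. B \<subseteq> V - W \<and> card B = r - e})"
  proof (rule bij_betw_byWitness[where f' = "\<lambda>(A, B). A \<union> B"])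
    show "(\<lambda>(A, B). A \<union> B) ` ({A. A \<subseteq> W \<and> card A = e} \<times> {B. B \<subseteq> V - W \<and> card B = r - e})
        \<subseteq> {C. C \<subseteq> V \<and> card C = r \<and> card (C \<inter> W) = e}"
    proof safe
      fix A B assume *: "A \<subseteq> W" "e = card A" "B \<subseteq> V - W" "card B = r - card A"
      have eqs: "(A \<union> B) \<inter> W = A" "(A \<union> B) - W = B" using * by auto
      show "card ((A \<union> B) \<inter> W) = card A" by (simp only: eqs)
      show "card (A \<union> B) = r"
        using split[of "A \<union> B"] * assms unfolding eqs by auto
      show "x \<in> V" if "x \<in> A" for x using that * assms by auto
      show "x \<in> V" if "x \<in> B" for x using that * assms by auto
    qed
  qed (use split assms in auto)
  thus ?thesis
    by (simp add: bij_betw_same_card card_cartesian_product n_subsets fin)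
qed

text \<open>The size of the intersection with \<open>W\<close> is hypergeometrically distributed
  over the \<open>r\<close>-subsets; this brings sums over subsets into the form evaluated
  above.\<close>

lemma sum_subsets_split:
  fixes f :: "nat \<Rightarrow> real"
  assumes "finite V" "W \<subseteq> V"
  shows "(\<Sum>C | C \<subseteq> V \<and> card C = r. f (card (C \<inter> W)))
     = (\<Sum>e\<le>r. f e * (real (card W choose e) * real (card (V - W) choose (r - e))))"
proof -
  let ?S = "{C. C \<subseteq> V \<and> card C = r}"
  have "finite ?S" using assms by simp
  moreover have "(\<lambda>C. card (C \<inter> W)) ` ?S \<subseteq> {..r}"
    using assms by (auto intro!: card_mono intro: finite_subset)
  ultimately have "(\<Sum>C\<in>?S. f (card (C \<inter> W)))
      = (\<Sum>e\<le>r. \<Sum>C | C \<in> ?S \<and> card (C \<inter> W) = e. f (card (C \<inter> W)))"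
    by (intro sum.group[symmetric]) auto
  also have "\<dots> = (\<Sum>e\<le>r. f e * real (card {C. C \<subseteq> V \<and> card C = r \<and> card (C \<inter> W) = e}))"
    by (intro sum.cong) (auto simp: conj_ac)
  also have "\<dots> = (\<Sum>e\<le>r. f e * (real (card W choose e) * real (card (V - W) choose (r - e))))"
    by (intro sum.cong) (auto simp: card_subsets_split[OF assms])
  finally show ?thesis .
qed

subsection \<open>Wallis bounds\<close>

text \<open>The recursion is the reduction formula that integration by parts yields for powers of
  the sine.\<close>

fun sin_power_antideriv :: "nat \<Rightarrow> real \<Rightarrow> real" where
  "sin_power_antideriv 0 x = x"
| "sin_power_antideriv (Suc 0) x = - cos x"
| "sin_power_antideriv (Suc (Suc n)) x =
     (- cos x * sin x ^ Suc n + real (Suc n) * sin_power_antideriv n x) / real (Suc (Suc n))"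

lemma sin_power_antideriv_deriv:
  "(sin_power_antideriv n has_real_derivative sin x ^ n) (at x)"
proof (induction n arbitrary: x rule: induct_nat_012)
  case (ge2 n)
  have cos_cos: "cos x * (cos x * y) = y - sin x * (sin x * y)" for y
    using sin_cos_squared_add[of x] by (metis add_diff_cancel_left' left_diff_distrib mult.assoc mult_1 power2_eq_square)
  have "((\<lambda>x. (- cos x * sin x ^ Suc n + real (Suc n) * sin_power_antideriv n x) / real (Suc (Suc n)))
      has_real_derivative sin x ^ Suc (Suc n)) (at x)"
    by (rule derivative_eq_intros ge2(1) refl | simp)+ (simp add: field_simps cos_cos)
  thus ?case by (simp only: sin_power_antideriv.simps(3)[abs_def])
qed (auto intro!: derivative_eq_intros simp: sin_power_antideriv.simps(1,2)[abs_def])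

text \<open>The integral of \<open>sin x ^ n\<close> over \<open>[0, pi / 2]\<close>.\<close>

definition wallis_integral :: "nat \<Rightarrow> real" where
  "wallis_integral n = sin_power_antideriv n (pi / 2) - sin_power_antideriv n 0"

lemma wallis_integral_simps:
  "wallis_integral 0 = pi / 2"
  "wallis_integral (Suc 0) = 1"
  "wallis_integral (Suc (Suc n)) = real (Suc n) / real (Suc (Suc n)) * wallis_integral n"
  by (simp_all add: wallis_integral_def diff_divide_distrib right_diff_distrib)

lemma wallis_integral_pos: "wallis_integral n > 0"
  by (induction n rule: induct_nat_012) (simp_all add: wallis_integral_simps)

text \<open>On \<open>[0, pi / 2]\<close> the sine lies between 0 and 1, so the difference of the
  two antiderivatives has a nonnegative derivative.\<close>

lemma wallis_integral_decreasing: "wallis_integral (Suc n) \<le> wallis_integral n"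
proof -
  let ?G = "\<lambda>x. sin_power_antideriv n x - sin_power_antideriv (Suc n) x"
  have "?G 0 \<le> ?G (pi / 2)"
  proof (rule DERIV_nonneg_imp_nondecreasing[where f = ?G])
    fix x :: real assume x: "0 \<le> x" "x \<le> pi / 2"
    have "(?G has_real_derivative sin x ^ n - sin x ^ Suc n) (at x)"
      by (intro DERIV_diff sin_power_antideriv_deriv)
    moreover have "sin x ^ Suc n \<le> sin x ^ n"
      using x by (intro power_decreasing sin_ge_zero) auto
    ultimately show "\<exists>y. (?G has_real_derivative y) (at x) \<and> 0 \<le> y"
      by (metis diff_ge_0_iff_ge)
  qed simp
  thus ?thesis by (simp add: wallis_integral_def)
qed

text \<open>The product is independent of \<open>n\<close>, because the factor from the reduction
  formula cancels against the change of the leading coefficient.\<close>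

lemma wallis_integral_consecutive:
  "real (Suc n) * (wallis_integral n * wallis_integral (Suc n)) = pi / 2"
proof (induction n)
  case (Suc n)
  have "real (Suc (Suc n)) * (wallis_integral (Suc n) * wallis_integral (Suc (Suc n)))
      = real (Suc n) * (wallis_integral n * wallis_integral (Suc n))"
    unfolding wallis_integral_simps by (simp add: field_simps del: of_nat_Suc)
  thus ?case using Suc.IH by (rule trans)
qed (simp add: wallis_integral_simps)

lemma wallis_integral_even: "wallis_integral (2 * k) = pi / 2 * central_binomial k / 4 ^ k"
proof (induction k)
  case 0
  show ?case by (simp add: wallis_integral_simps central_binomial_def)
next
  case (Suc k)
  have c: "central_binomial (Suc k) = 2 * (2 * real k + 1) * central_binomial k / (real k + 1)"
    using central_binomial_weighted_Suc[of k] by (simp add: field_simps)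
  have "wallis_integral (2 * Suc k) = (2 * real k + 1) / (2 * real k + 2) * wallis_integral (2 * k)"
    by (simp add: wallis_integral_simps add_ac)
  thus ?case unfolding Suc.IH c by (simp add: divide_simps) (simp add: algebra_simps)
qed

text \<open>The quotient is \<open>(pi / 2) / w\<close>. Replacing one factor of
  \<open>w\<^sup>2\<close> by the preceding or the following Wallis integral bounds
  \<open>w\<^sup>2\<close> from above or below, since products of neighbours are known
  exactly.\<close>

lemma central_binomial_bounds:
  "pi * real k \<le> (4 ^ k / central_binomial k)\<^sup>2"
  "(4 ^ k / central_binomial k)\<^sup>2 \<le> pi * real k + pi / 2"
proof -
  define w where "w = wallis_integral (2 * k)"
  have w: "w > 0" unfolding w_def by (rule wallis_integral_pos)
  have c: "central_binomial k > 0" by (simp add: central_binomial_def)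
  have eq: "(4 ^ k / central_binomial k)\<^sup>2 = (pi / 2)\<^sup>2 / w\<^sup>2"
    using c w unfolding power_divide[symmetric]
    by (intro arg_cong[where f = "\<lambda>x. x\<^sup>2"]) (simp add: w_def wallis_integral_even)
  have "2 * real k * w\<^sup>2 \<le> pi / 2"
  proof (cases k)
    case (Suc m)
    have "2 * real k * w\<^sup>2 \<le> 2 * real k * (wallis_integral (Suc (2 * m)) * w)"
      using w wallis_integral_decreasing[of "Suc (2 * m)"]
      by (intro mult_left_mono) (auto simp: power2_eq_square w_def Suc)
    also have "\<dots> = pi / 2"
      using wallis_integral_consecutive[of "Suc (2 * m)"] by (simp add: w_def Suc algebra_simps)
    finally show ?thesis .
  qed simp
  hence "pi * real k * w\<^sup>2 \<le> (pi / 2)\<^sup>2"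
    using mult_left_mono[of "2 * real k * w\<^sup>2" "pi / 2" "pi / 2"] by (simp add: power2_eq_square)
  thus "pi * real k \<le> (4 ^ k / central_binomial k)\<^sup>2"
    using w by (simp add: eq pos_le_divide_eq)
  have "pi / 2 = real (2 * k + 1) * (w * wallis_integral (Suc (2 * k)))"
    using wallis_integral_consecutive[of "2 * k"] by (simp add: w_def)
  also have "\<dots> \<le> real (2 * k + 1) * w\<^sup>2"
    using w wallis_integral_decreasing[of "2 * k"] unfolding power2_eq_square
    by (intro mult_left_mono) (auto simp: w_def)
  finally have "(pi / 2)\<^sup>2 \<le> pi / 2 * (real (2 * k + 1) * w\<^sup>2)"
    using mult_left_mono[of "pi / 2" "real (2 * k + 1) * w\<^sup>2" "pi / 2"] by (simp add: power2_eq_square)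
  thus "(4 ^ k / central_binomial k)\<^sup>2 \<le> pi * real k + pi / 2"
    using w by (simp add: eq pos_divide_le_eq algebra_simps)
qed

lemma central_binomial_asymp: "(\<lambda>n. 4 ^ n / central_binomial n) \<sim>[at_top] (\<lambda>n. sqrt (pi * real n))"
proof (rule asymp_equiv_sandwich_real)
  show "(\<lambda>n. sqrt (pi * real n)) \<sim>[at_top] (\<lambda>n. sqrt (pi * real n))" by simp
  have "(\<lambda>n. sqrt (pi * real n + pi / 2) / sqrt (pi * real n)) \<longlonglongrightarrow> 1"
    by real_asymp
  thus "(\<lambda>n. sqrt (pi * real n + pi / 2)) \<sim>[at_top] (\<lambda>n. sqrt (pi * real n))"
    by (intro asymp_equivI') 
  show "\<forall>\<^sub>F n in at_top. 4 ^ n / central_binomial n \<in> {sqrt (pi * real n)..sqrt (pi * real n + pi / 2)}"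
    using central_binomial_bounds
    by (intro always_eventually) (auto intro!: real_le_rsqrt real_le_lsqrt simp: central_binomial_def)
qed

subsection \<open>Planar rook diagrams as subsets of the vertices\<close>

text \<open>These are the graphs of order-preserving partial bijections: the single equivalence,
  used for both orders of two pairs, also yields functionality and injectivity.\<close>

definition order_matchings :: "nat \<Rightarrow> (nat \<times> nat) set set" where
  "order_matchings n =
     {R. R \<subseteq> {1..n} \<times> {1..n} \<and> (\<forall>(a, c)\<in>R. \<forall>(b, d)\<in>R. a < b \<longleftrightarrow> c < d)}"

lemma order_matchings_less:
  "R \<in> order_matchings n \<Longrightarrow> (a, c) \<in> R \<Longrightarrow> (b, d) \<in> R \<Longrightarrow> a < b \<longleftrightarrow> c < d"
  unfolding order_matchings_def by blast

lemma order_matchings_eq: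
  "R \<in> order_matchings n \<Longrightarrow> (a, c) \<in> R \<Longrightarrow> (b, d) \<in> R \<Longrightarrow> a = b \<longleftrightarrow> c = d"
  using order_matchings_less[of R n a c b d] order_matchings_less[of R n b d a c] by arith

lemma order_matchings_bounds:
  "R \<in> order_matchings n \<Longrightarrow> (a, c) \<in> R \<Longrightarrow> a \<in> {1..n} \<and> c \<in> {1..n}"
  unfolding order_matchings_def by blast

lemma finite_order_matching: "R \<in> order_matchings n \<Longrightarrow> finite R"
  unfolding order_matchings_def by (auto intro: finite_subset)

section \<open>Diagrams and order-preserving partial bijections\<close>

lemma vertices_simps [simp]:
  "Top a \<in> vertices n \<longleftrightarrow> a \<in> {1..n}" "Bot a \<in> vertices n \<longleftrightarrow> a \<in> {1..n}"
  by (auto simp: vertices_def)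

lemma planar_rook_diagrams_block_eq:
  assumes "X \<in> planar_rook_diagrams n" "B \<in> X" "B' \<in> X" "v \<in> B" "v \<in> B'"
  shows "B = B'"
  using assms unfolding planar_rook_diagrams_def partition_on_def disjoint_def by blast

lemma planar_rook_diagrams_cover:
  assumes "X \<in> planar_rook_diagrams n"
  shows "v \<in> vertices n \<longleftrightarrow> (\<exists>B\<in>X. v \<in> B)"
  using assms unfolding planar_rook_diagrams_def partition_on_def by blast

lemma planar_rook_diagrams_block_cases:
  assumes "X \<in> planar_rook_diagrams n" "B \<in> X"
  obtains a where "B = {Top a}" | c where "B = {Bot c}" | a c where "B = {Top a, Bot c}"
  using assms unfolding planar_rook_diagrams_def by (auto, metis vertex.exhaust)

text \<open>Disjoint blocks give the equivalence for equality and planarity rules out inversions;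
  trichotomy then yields the equivalence for the strict order.\<close>

lemma transversals_order_matching:
  assumes X: "X \<in> planar_rook_diagrams n"
  shows "transversals X \<in> order_matchings n"
proof -
  have bounds: "a \<in> {1..n} \<and> c \<in> {1..n}" if "(a, c) \<in> transversals X" for a c
    using that planar_rook_diagrams_cover[OF X, of "Top a"] planar_rook_diagrams_cover[OF X, of "Bot c"]
    by (auto simp: transversals_def)
  have eq: "a = b \<longleftrightarrow> c = d" if "(a, c) \<in> transversals X" "(b, d) \<in> transversals X" for a b c d
    using that planar_rook_diagrams_block_eq[OF X, of "{Top a, Bot c}" "{Top b, Bot d}" "Top a"]
      planar_rook_diagrams_block_eq[OF X, of "{Top a, Bot c}" "{Top b, Bot d}" "Bot c"]
    by (auto simp: transversals_def doubleton_eq_iff)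
  have planar: "\<not> (a < b \<and> d < c)" if "(a, c) \<in> transversals X" "(b, d) \<in> transversals X" for a b c d
    using that X unfolding planar_rook_diagrams_def planar_def by blast
  have less: "a < b \<longleftrightarrow> c < d" if 1: "(a, c) \<in> transversals X" and 2: "(b, d) \<in> transversals X" for a b c d
    using eq[OF 1 2] planar[OF 1 2] planar[OF 2 1] by linarith
  show ?thesis
    unfolding order_matchings_def mem_Collect_eq case_prod_unfold
  proof (intro conjI ballI)
    show "transversals X \<subseteq> {1..n} \<times> {1..n}" using bounds by auto
    fix p q assume "p \<in> transversals X" "q \<in> transversals X"
    thus "fst p < fst q \<longleftrightarrow> snd p < snd q"
      using less by (cases p; cases q) simp
  qed
qed

lemma top_dots_eq:
  assumes X: "X \<in> planar_rook_diagrams n"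
  shows "top_dots X = {1..n} - Domain (transversals X)"
proof (intro equalityI subsetI)
  fix i assume i: "i \<in> top_dots X"
  have "i \<notin> Domain (transversals X)"
  proof
    assume "i \<in> Domain (transversals X)"
    then obtain c where "{Top i, Bot c} \<in> X" by (auto simp: transversals_def)
    with i have "{Top i} = {Top i, Bot c}"
      using planar_rook_diagrams_block_eq[OF X, of "{Top i}" "{Top i, Bot c}" "Top i"]
      by (auto simp: top_dots_def)
    thus False by auto
  qed
  with i show "i \<in> {1..n} - Domain (transversals X)"
    using planar_rook_diagrams_cover[OF X, of "Top i"] by (auto simp: top_dots_def)
next
  fix i assume i: "i \<in> {1..n} - Domain (transversals X)"
  then obtain B where B: "B \<in> X" "Top i \<in> B"
    using planar_rook_diagrams_cover[OF X, of "Top i"] by auto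
  with i show "i \<in> top_dots X"
    by (cases rule: planar_rook_diagrams_block_cases[OF X B(1)])
       (auto simp: top_dots_def transversals_def)
qed

lemma bottom_dots_eq:
  assumes X: "X \<in> planar_rook_diagrams n"
  shows "bottom_dots X = {1..n} - Range (transversals X)"
proof (intro equalityI subsetI)
  fix i assume i: "i \<in> bottom_dots X"
  have "i \<notin> Range (transversals X)"
  proof
    assume "i \<in> Range (transversals X)"
    then obtain a where "{Top a, Bot i} \<in> X" by (auto simp: transversals_def)
    with i have "{Bot i} = {Top a, Bot i}"
      using planar_rook_diagrams_block_eq[OF X, of "{Bot i}" "{Top a, Bot i}" "Bot i"]
      by (auto simp: bottom_dots_def)
    thus False by auto
  qed
  with i show "i \<in> {1..n} - Range (transversals X)"
    using planar_rook_diagrams_cover[OF X, of "Bot i"] by (auto simp: bottom_dots_def)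
next
  fix i assume i: "i \<in> {1..n} - Range (transversals X)"
  then obtain B where B: "B \<in> X" "Bot i \<in> B"
    using planar_rook_diagrams_cover[OF X, of "Bot i"] by auto
  with i show "i \<in> bottom_dots X"
    by (cases rule: planar_rook_diagrams_block_cases[OF X B(1)])
       (auto simp: bottom_dots_def transversals_def)
qed

lemma transversals_diagram_of: "transversals (diagram_of n R) = R"
  by (auto simp: transversals_def diagram_of_def doubleton_eq_iff)

lemma diagram_of_transversals:
  assumes X: "X \<in> planar_rook_diagrams n"
  shows "diagram_of n (transversals X) = X"
proof -
  have "diagram_of n (transversals X) = (\<lambda>(a, c). {Top a, Bot c}) ` transversals X
      \<union> (\<lambda>a. {Top a}) ` top_dots X \<union> (\<lambda>c. {Bot c}) ` bottom_dots X"
    using X by (simp add: diagram_of_def top_dots_eq bottom_dots_eq)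
  also have "\<dots> = X"
  proof (intro equalityI subsetI)
    fix B assume "B \<in> X"
    thus "B \<in> (\<lambda>(a, c). {Top a, Bot c}) ` transversals X
      \<union> (\<lambda>a. {Top a}) ` top_dots X \<union> (\<lambda>c. {Bot c}) ` bottom_dots X"
      by (cases rule: planar_rook_diagrams_block_cases[OF X \<open>B \<in> X\<close>])
         (auto simp: top_dots_def bottom_dots_def transversals_def)
  qed (auto simp: top_dots_def bottom_dots_def transversals_def)
  finally show ?thesis .
qed

lemma diagram_of_planar_rook:
  assumes R: "R \<in> order_matchings n"
  shows "diagram_of n R \<in> planar_rook_diagrams n"
proof -
  have "planar (diagram_of n R)"
    unfolding planar_def transversals_diagram_of using order_matchings_less[OF R] less_asym by blast
  moreover have "\<Union> (diagram_of n R) = vertices n"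
  proof (intro equalityI subsetI)
    fix v assume v: "v \<in> vertices n"
    show "v \<in> \<Union> (diagram_of n R)"
    proof (cases v)
      case (Top a)
      with v show ?thesis by (cases "a \<in> Domain R") (force simp: diagram_of_def)+
    next
      case (Bot c)
      with v show ?thesis by (cases "c \<in> Range R") (force simp: diagram_of_def)+
    qed
  qed (auto simp: diagram_of_def dest!: order_matchings_bounds[OF R])
  moreover have "B = B'" if "B \<in> diagram_of n R" "B' \<in> diagram_of n R" "v \<in> B" "v \<in> B'" for B B' v
    using that order_matchings_eq[OF R] by (cases v) (auto simp: diagram_of_def)
  hence "disjoint (diagram_of n R)"
    unfolding disjoint_def by blast
  moreover have "{} \<notin> diagram_of n R"
    by (auto simp: diagram_of_def)
  ultimately show ?thesis
    unfolding planar_rook_diagrams_def partition_on_def by (auto simp: diagram_of_def)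
qed

lemma bij_betw_transversals:
  "bij_betw transversals (planar_rook_diagrams n) (order_matchings n)"
  by (rule bij_betw_byWitness[where f' = "diagram_of n"])
     (auto simp: transversals_diagram_of diagram_of_transversals transversals_order_matching
       diagram_of_planar_rook)

section \<open>Counting the endpoints of a matching\<close>

lemma inj_on_fst_order_matching:
  assumes "R \<in> order_matchings n"
  shows "inj_on fst R"
proof (rule inj_onI)
  fix p q assume "p \<in> R" "q \<in> R" "fst p = fst q"
  thus "p = q"
    using order_matchings_eq[OF assms, of "fst p" "snd p" "fst q" "snd q"] by (cases p; cases q) auto
qed

lemma inj_on_snd_order_matching:
  assumes "R \<in> order_matchings n"
  shows "inj_on snd R"
proof (rule inj_onI)
  fix p q assume "p \<in> R" "q \<in> R" "snd p = snd q"
  thus "p = q"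
    using order_matchings_eq[OF assms, of "fst p" "snd p" "fst q" "snd q"] by (cases p; cases q) auto
qed

text \<open>Pairs are determined by their top endpoints. The predicate is later a rank condition, a
  cut at column \<open>j\<close>, or constantly true to obtain the total number of pairs.\<close>

lemma card_Domain_order_matching:
  assumes "R \<in> order_matchings n"
  shows "card {x \<in> Domain R. P x} = card {p \<in> R. P (fst p)}"
proof -
  have "inj_on fst {p \<in> R. P (fst p)}"
    using inj_on_fst_order_matching[OF assms] by (rule inj_on_subset) blast
  moreover have "fst ` {p \<in> R. P (fst p)} = {x \<in> Domain R. P x}"
    by (auto simp: image_iff)
  ultimately show ?thesis using card_image by fastforce
qed

lemma card_Range_order_matching:
  assumes "R \<in> order_matchings n"
  shows "card {x \<in> Range R. P x} = card {p \<in> R. P (snd p)}"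
proof -
  have "inj_on snd {p \<in> R. P (snd p)}"
    using inj_on_snd_order_matching[OF assms] by (rule inj_on_subset) blast
  moreover have "snd ` {p \<in> R. P (snd p)} = {x \<in> Range R. P x}"
    by (auto simp: image_iff)
  ultimately show ?thesis using card_image by fastforce
qed

section \<open>Ranks and the reconstruction of a matching from its endpoints\<close>

definition rank_in :: "nat set \<Rightarrow> nat \<Rightarrow> nat" where
  "rank_in S x = card {y \<in> S. y < x}"

lemma rank_in_less_iff:
  assumes "finite S" "x \<in> S" "y \<in> S"
  shows "rank_in S x < rank_in S y \<longleftrightarrow> x < y"
proof -
  have less: "rank_in S x < rank_in S y" if "x \<in> S" "x < y" for x y
    unfolding rank_in_def
  proof (rule psubset_card_mono)
    have "x \<in> {z \<in> S. z < y}" "x \<notin> {z \<in> S. z < x}" using that by auto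
    moreover have "{z \<in> S. z < x} \<subseteq> {z \<in> S. z < y}" using that by auto
    ultimately show "{z \<in> S. z < x} \<subset> {z \<in> S. z < y}" by blast
  qed (use assms(1) in simp)
  show ?thesis
    using less[OF assms(2), of y] less[OF assms(3), of x]
    by (cases x y rule: linorder_cases) simp_all
qed

text \<open>Ranks start at 0 and increase strictly, so they inject \<open>S\<close> into an initial
  segment of the same size.\<close>

lemma bij_betw_rank_in:
  assumes "finite S"
  shows "bij_betw (rank_in S) S {..<card S}"
proof -
  have inj: "inj_on (rank_in S) S"
  proof (rule inj_onI)
    fix x y assume "x \<in> S" "y \<in> S" "rank_in S x = rank_in S y"
    thus "x = y"
      using rank_in_less_iff[OF assms, of x y] rank_in_less_iff[OF assms, of y x] by simp
  qed
  have "rank_in S ` S \<subseteq> {..<card S}"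
    unfolding rank_in_def using assms by (auto intro!: psubset_card_mono)
  thus ?thesis
    using inj by (intro bij_betw_imageI card_subset_eq) (auto simp: card_image)
qed

text \<open>For finite sets of equal size this is the graph of the unique order-preserving bijection
  from \<open>A\<close> to \<open>B\<close>.\<close>

definition rank_matching :: "nat set \<Rightarrow> nat set \<Rightarrow> (nat \<times> nat) set" where
  "rank_matching A B = {(a, c) \<in> A \<times> B. rank_in A a = rank_in B c}"

lemma rank_matching_in_order_matchings:
  assumes "A \<subseteq> {1..n}" "B \<subseteq> {1..n}"
  shows "rank_matching A B \<in> order_matchings n"
proof -
  have "finite A" "finite B" using assms finite_subset by auto
  note less = rank_in_less_iff[OF this(1)] rank_in_less_iff[OF this(2)]
  show ?thesis
    unfolding order_matchings_def mem_Collect_eq case_prod_unfold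
  proof (intro conjI ballI)
    show "rank_matching A B \<subseteq> {1..n} \<times> {1..n}"
      using assms by (auto simp: rank_matching_def)
    fix p q assume "p \<in> rank_matching A B" "q \<in> rank_matching A B"
    thus "fst p < fst q \<longleftrightarrow> snd p < snd q"
      by (auto simp: rank_matching_def less[symmetric])
  qed
qed

text \<open>Equal sizes make both rank functions exhaust the same initial segment, so every element
  finds a partner.\<close>

lemma Domain_Range_rank_matching:
  assumes "finite A" "finite B" "card A = card B"
  shows "Domain (rank_matching A B) = A" "Range (rank_matching A B) = B"
proof -
  have eq: "rank_in A ` A = rank_in B ` B"
    using bij_betw_rank_in[OF assms(1)] bij_betw_rank_in[OF assms(2)] assms(3)
    by (simp add: bij_betw_def)
  have "\<exists>c\<in>B. rank_in A a = rank_in B c" if "a \<in> A" for a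
    using imageI[OF that, of "rank_in A"] unfolding eq by auto
  moreover have "\<exists>a\<in>A. rank_in A a = rank_in B c" if "c \<in> B" for c
    using imageI[OF that, of "rank_in B"] unfolding eq[symmetric] by auto
  ultimately show "Domain (rank_matching A B) = A" "Range (rank_matching A B) = B"
    by (auto simp: rank_matching_def Domain_iff Range_iff)
qed

text \<open>The pairs to the left of \<open>(a, c)\<close> on top are the same as those to its left
  at the bottom.\<close>

lemma rank_in_order_matching:
  assumes R: "R \<in> order_matchings n" and "(a, c) \<in> R"
  shows "rank_in (Domain R) a = rank_in (Range R) c"
proof -
  have "fst p < a \<longleftrightarrow> snd p < c" if "p \<in> R" for p
    using order_matchings_less[OF R, of "fst p" "snd p" a c] that assms(2) by simp
  hence "{p \<in> R. fst p < a} = {p \<in> R. snd p < c}" by auto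
  thus ?thesis
    unfolding rank_in_def card_Domain_order_matching[OF R] card_Range_order_matching[OF R] by simp
qed

text \<open>If \<open>a\<close> and \<open>c\<close> have equal rank, the partner \<open>d\<close>
  of \<open>a\<close> in \<open>R\<close> has the rank of \<open>c\<close> as well, and injectivity
  of ranks forces \<open>d = c\<close>.\<close>

lemma rank_matching_Domain_Range:
  assumes R: "R \<in> order_matchings n"
  shows "rank_matching (Domain R) (Range R) = R"
proof (intro equalityI subsetI)
  fix p assume "p \<in> rank_matching (Domain R) (Range R)"
  then obtain a c where p: "p = (a, c)" "a \<in> Domain R" "c \<in> Range R"
    "rank_in (Domain R) a = rank_in (Range R) c"
    by (auto simp: rank_matching_def)
  then obtain d where d: "(a, d) \<in> R" by auto
  hence "rank_in (Range R) d = rank_in (Range R) c" "d \<in> Range R"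
    using rank_in_order_matching[OF R] p by auto
  moreover have "finite (Range R)" using finite_order_matching[OF R] by (rule finite_Range)
  ultimately have "d = c"
    using p(3) bij_betw_imp_inj_on[OF bij_betw_rank_in] by (metis inj_on_eq_iff)
  thus "p \<in> R" using d p by simp
qed (use rank_in_order_matching[OF R] in \<open>auto simp: rank_matching_def\<close>)

section \<open>Encoding matchings by \<open>n\<close>-subsets of the vertices\<close>

definition profile :: "nat \<Rightarrow> (nat \<times> nat) set \<Rightarrow> vertex set" where
  "profile n R = Top ` Domain R \<union> Bot ` ({1..n} - Range R)"

lemma finite_vertices [simp]: "finite (vertices n)"
  by (simp add: vertices_def)

lemma card_vertices: "card (vertices n) = 2 * n"
  unfolding vertices_def by (subst card_Un_disjoint) (auto simp: card_image inj_on_def)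

lemma card_vertex_set:
  assumes "finite A" "finite B"
  shows "card (Top ` A \<union> Bot ` B) = card A + card B"
  using assms by (subst card_Un_disjoint) (auto simp: card_image inj_on_def)

text \<open>The inverse reads off both endpoint sets and joins them by rank. The condition
  \<open>card C = n\<close> expresses that these sets have the same size.\<close>

lemma bij_betw_profile:
  "bij_betw (profile n) (order_matchings n) {C. C \<subseteq> vertices n \<and> card C = n}"
proof (rule bij_betw_byWitness
    [where f' = "\<lambda>C. rank_matching {a. Top a \<in> C} ({1..n} - {c. Bot c \<in> C})"], goal_cases)
  \<comment> \<open>Cases 1 and 2 show that the maps are mutually inverse, cases 3 and 4 that each
    lands in the domain of the other.\<close>
  case 1
  show ?case
  proof
    fix R assume R: "R \<in> order_matchings n"
    have "{a. Top a \<in> profile n R} = Domain R" "{1..n} - {c. Bot c \<in> profile n R} = Range R"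
      using order_matchings_bounds[OF R] by (auto simp: profile_def)
    thus "rank_matching {a. Top a \<in> profile n R} ({1..n} - {c. Bot c \<in> profile n R}) = R"
      using rank_matching_Domain_Range[OF R] by simp
  qed
next
  case 2
  show ?case
  proof
    fix C assume "C \<in> {C. C \<subseteq> vertices n \<and> card C = n}"
    hence C: "C \<subseteq> vertices n" "card C = n" by auto
    define A B where "A = {a. Top a \<in> C}" and "B = {c. Bot c \<in> C}"
    have sub: "A \<subseteq> {1..n}" "B \<subseteq> {1..n}"
      using C(1) by (auto simp: A_def B_def)
    hence fin: "finite A" "finite B" by (auto intro: finite_subset)
    have C_eq: "C = Top ` A \<union> Bot ` B"
    proof (intro equalityI subsetI)
      fix v assume "v \<in> C"
      thus "v \<in> Top ` A \<union> Bot ` B" by (cases v) (simp_all add: A_def B_def)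
    qed (auto simp: A_def B_def)
    have "card A + card B = n" using C(2) card_vertex_set[OF fin] C_eq by simp
    hence "card A = card ({1..n} - B)" using sub fin by (simp add: card_Diff_subset)
    hence "profile n (rank_matching A ({1..n} - B)) = Top ` A \<union> Bot ` ({1..n} - ({1..n} - B))"
      using fin by (simp add: profile_def Domain_Range_rank_matching)
    also have "\<dots> = C" using sub C_eq by (simp add: double_diff)
    finally show "profile n (rank_matching {a. Top a \<in> C} ({1..n} - {c. Bot c \<in> C})) = C"
      unfolding A_def B_def .
  qed
next
  case 3
  show ?case
  proof safe
    fix R assume R: "R \<in> order_matchings n"
    show "v \<in> vertices n" if "v \<in> profile n R" for v
      using that order_matchings_bounds[OF R] by (auto simp: profile_def)
    have "card (Domain R) = card (Range R)"
      using card_Domain_order_matching[OF R, of "\<lambda>_. True"]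
        card_Range_order_matching[OF R, of "\<lambda>_. True"] by simp
    moreover have sub: "Range R \<subseteq> {1..n}" using order_matchings_bounds[OF R] by auto
    moreover have "finite (Range R)" using sub by (rule finite_subset) simp
    moreover have "card (Range R) \<le> n" using card_mono[OF _ sub] by simp
    ultimately show "card (profile n R) = n"
      unfolding profile_def using finite_order_matching[OF R]
      by (subst card_vertex_set) (auto simp: card_Diff_subset finite_Domain)
  qed
next
  case 4
  show ?case
    by (auto intro!: rank_matching_in_order_matchings)
qed

subsection \<open>Length of the factorization\<close>

text \<open>The index \<open>j\<close> stands for the cut between columns \<open>j\<close> and
  \<open>j + 1\<close>; the cuts separating \<open>a\<close> from \<open>c\<close> form the interval
  from \<open>min a c\<close> up to, but excluding, \<open>max a c\<close>.\<close>

lemma sum_if_between: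
  fixes a c n :: nat
  assumes "a \<le> n" "c \<le> n"
  shows "\<bar>real a - real c\<bar> = (\<Sum>j\<le>n. if a \<le> j \<and> j < c \<or> c \<le> j \<and> j < a then 1 else 0)"
proof -
  have "(\<Sum>j\<le>n. if a \<le> j \<and> j < c \<or> c \<le> j \<and> j < a then 1 else 0 :: real)
      = real (card {j \<in> {..n}. a \<le> j \<and> j < c \<or> c \<le> j \<and> j < a})"
    by (subst sum.inter_filter[symmetric]) auto
  also have "{j \<in> {..n}. a \<le> j \<and> j < c \<or> c \<le> j \<and> j < a} = {min a c..<max a c}"
    using assms by auto
  finally show ?thesis by (simp add: of_nat_diff max_def min_def)
qed

text \<open>Pairs with both ends left of the cut cancel in the difference. Of the two kinds of
  crossing pairs one is absent, so the absolute difference is the number of all crossing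
  pairs.\<close>

lemma order_matching_cut:
  assumes R: "R \<in> order_matchings n"
  shows "\<bar>real (card {a \<in> Domain R. a \<le> j}) - real (card {c \<in> Range R. c \<le> j})\<bar>
     = (\<Sum>(a, c)\<in>R. if a \<le> j \<and> j < c \<or> c \<le> j \<and> j < a then 1 else 0)"
proof -
  let ?U = "{p \<in> R. fst p \<le> j \<and> j < snd p}" and ?D = "{p \<in> R. snd p \<le> j \<and> j < fst p}"
    and ?S = "{p \<in> R. fst p \<le> j \<and> snd p \<le> j}"
  have fin: "finite ?U" "finite ?D" "finite ?S"
    using finite_order_matching[OF R] by simp_all
  have "{p \<in> R. fst p \<le> j} = ?U \<union> ?S" "{p \<in> R. snd p \<le> j} = ?D \<union> ?S" by auto
  moreover have "card (?U \<union> ?S) = card ?U + card ?S" "card (?D \<union> ?S) = card ?D + card ?S"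
    using fin by (auto intro!: card_Un_disjoint)
  ultimately have diff: "real (card {a \<in> Domain R. a \<le> j}) - real (card {c \<in> Range R. c \<le> j})
      = real (card ?U) - real (card ?D)"
    unfolding card_Domain_order_matching[OF R] card_Range_order_matching[OF R] by simp
  \<comment> \<open>Such pairs would violate order preservation:
    \<open>fst p \<le> j < fst q\<close> but \<open>snd q \<le> j < snd p\<close>.\<close>
  have "\<not> (p \<in> ?U \<and> q \<in> ?D)" for p q
    using order_matchings_less[OF R, of "fst p" "snd p" "fst q" "snd q"] by auto
  hence "?U = {} \<or> ?D = {}" by blast
  hence "card ?U = 0 \<or> card ?D = 0" by (elim disjE) (simp_all only: card.empty simp_thms)
  hence "\<bar>real (card ?U) - real (card ?D)\<bar> = real (card ?U + card ?D)" by linarith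
  also have "card ?U + card ?D = card (?U \<union> ?D)"
    using fin by (intro card_Un_disjoint[symmetric]) auto
  also have "?U \<union> ?D = {p \<in> R. fst p \<le> j \<and> j < snd p \<or> snd p \<le> j \<and> j < fst p}" by auto
  also have "real (card \<dots>)
      = (\<Sum>p\<in>R. if fst p \<le> j \<and> j < snd p \<or> snd p \<le> j \<and> j < fst p then 1 else 0)"
    using finite_order_matching[OF R] by (simp add: sum.inter_filter[symmetric])
  finally show ?thesis by (simp only: diff case_prod_unfold)
qed

lemma sum_displacement:
  assumes R: "R \<in> order_matchings n"
  shows "(\<Sum>(a, c)\<in>R. \<bar>real a - real c\<bar>)
     = (\<Sum>j\<le>n. \<bar>real (card (profile n R \<inter> vertices j)) - real j\<bar>)"
proof -
  have "(\<Sum>(a, c)\<in>R. \<bar>real a - real c\<bar>)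
      = (\<Sum>(a, c)\<in>R. \<Sum>j\<le>n. if a \<le> j \<and> j < c \<or> c \<le> j \<and> j < a then 1 else 0)"
    by (intro sum.cong refl) (use order_matchings_bounds[OF R] in \<open>auto intro!: sum_if_between\<close>)
  also have "\<dots> = (\<Sum>j\<le>n. \<Sum>(a, c)\<in>R. if a \<le> j \<and> j < c \<or> c \<le> j \<and> j < a then 1 else 0)"
    unfolding case_prod_unfold by (rule sum.swap)
  also have "\<dots> = (\<Sum>j\<le>n. \<bar>real (card (profile n R \<inter> vertices j)) - real j\<bar>)"
  proof (intro sum.cong refl)
    fix j assume "j \<in> {..n}"
    let ?A = "{a \<in> Domain R. a \<le> j}" and ?B = "{c \<in> Range R. c \<le> j}"
    \<comment> \<open>The bottom row contributes \<open>j - card ?B\<close>, so the count exceeds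
      \<open>j\<close> by exactly the difference in the cut lemma.\<close>
    have eq: "profile n R \<inter> vertices j = Top ` ?A \<union> Bot ` ({1..j} - ?B)"
      using order_matchings_bounds[OF R] \<open>j \<in> {..n}\<close> by (auto simp: profile_def vertices_def)
    have sub: "?B \<subseteq> {1..j}" using order_matchings_bounds[OF R] by auto
    hence "card ?B \<le> j" using card_mono[of "{1..j}" ?B] by simp
    moreover have "finite ?A" "finite ?B"
      using finite_order_matching[OF R] by (auto simp: finite_Domain finite_Range)
    ultimately have "real (card (profile n R \<inter> vertices j)) - real j = real (card ?A) - real (card ?B)"
      unfolding eq using sub by (subst card_vertex_set) (auto simp: card_Diff_subset of_nat_diff)
    thus "(\<Sum>(a, c)\<in>R. if a \<le> j \<and> j < c \<or> c \<le> j \<and> j < a then 1 else 0)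
        = \<bar>real (card (profile n R \<inter> vertices j)) - real j\<bar>"
      using order_matching_cut[OF R, of j] by simp
  qed
  finally show ?thesis .
qed

lemma length_concat_map_sorted_list_of_set:
  "finite S \<Longrightarrow> length (concat (map f (sorted_list_of_set S))) = (\<Sum>x\<in>S. length (f x))"
  "finite S \<Longrightarrow> length (concat (map f (rev (sorted_list_of_set S)))) = (\<Sum>x\<in>S. length (f x))"
  by (simp_all add: length_concat comp_def rev_map[symmetric] sum_list_distinct_conv_sum_set)

text \<open>Each row has \<open>n - card R\<close> dots, each costing two generators, and the word
  for a pair has one letter per column of displacement.\<close>

lemma output_length_eq:
  assumes X: "X \<in> planar_rook_diagrams n"
  defines "R \<equiv> transversals X"
  shows "real (output_length n X)
     = 4 * (real n - real (card R)) + (\<Sum>(a, c)\<in>R. \<bar>real a - real c\<bar>)"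
proof -
  have R: "R \<in> order_matchings n"
    unfolding R_def using X by (rule transversals_order_matching)
  note finR = finite_order_matching[OF R]
  have sub: "Domain R \<subseteq> {1..n}" "Range R \<subseteq> {1..n}" using order_matchings_bounds[OF R] by auto
  have cards: "card (Domain R) = card R" "card (Range R) = card R"
    using card_Domain_order_matching[OF R, of "\<lambda>_. True"]
      card_Range_order_matching[OF R, of "\<lambda>_. True"] by simp_all
  have le: "card R \<le> n" using card_mono[OF _ sub(1)] cards by simp
  have dots: "card (top_dots X) = n - card R" "card (bottom_dots X) = n - card R"
    using sub finite_subset[OF sub(1)] finite_subset[OF sub(2)] cards
    by (simp_all add: top_dots_eq[OF X] bottom_dots_eq[OF X] R_def[symmetric] card_Diff_subset)
  have fin_dots: "finite (top_dots X)" "finite (bottom_dots X)"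
    by (simp_all add: top_dots_eq[OF X] bottom_dots_eq[OF X])
  let ?U = "{(a, c). (a, c) \<in> R \<and> a < c}" and ?D = "{(a, c). (a, c) \<in> R \<and> a > c}"
  have fin: "finite ?U" "finite ?D"
    using finR by (auto intro: finite_subset[OF _ finR])
  have "real (output_length n X) = 4 * (real n - real (card R))
      + (\<Sum>(a, c)\<in>?U. \<bar>real a - real c\<bar>) + (\<Sum>(a, c)\<in>?D. \<bar>real a - real c\<bar>)"
  proof -
    have "length (dot_word n i) = 2" for i by (simp add: dot_word_def)
    hence "output_length n X = 4 * (n - card R)
        + (\<Sum>(a, c)\<in>?U. length (l_word n a c)) + (\<Sum>(a, c)\<in>?D. length (r_word n a c))"
      unfolding output_length_def factorization_def R_def[symmetric]
      using fin fin_dots dots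
      by (simp add: length_concat_map_sorted_list_of_set case_prod_unfold del: length_concat)
    moreover have "real (\<Sum>(a, c)\<in>?U. length (l_word n a c)) = (\<Sum>(a, c)\<in>?U. \<bar>real a - real c\<bar>)"
      unfolding of_nat_sum by (intro sum.cong) (auto simp: l_word_def of_nat_diff)
    moreover have "real (\<Sum>(a, c)\<in>?D. length (r_word n a c)) = (\<Sum>(a, c)\<in>?D. \<bar>real a - real c\<bar>)"
      unfolding of_nat_sum by (intro sum.cong) (auto simp: r_word_def of_nat_diff)
    ultimately show ?thesis using le by (simp add: of_nat_diff)
  qed
  also have "\<dots> = 4 * (real n - real (card R)) + (\<Sum>(a, c)\<in>?U \<union> ?D. \<bar>real a - real c\<bar>)"
    using fin by (subst sum.union_disjoint) auto
  \<comment> \<open>Vertical pairs have displacement 0.\<close>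
  also have "(\<Sum>(a, c)\<in>?U \<union> ?D. \<bar>real a - real c\<bar>) = (\<Sum>(a, c)\<in>R. \<bar>real a - real c\<bar>)"
    using finR by (intro sum.mono_neutral_left) auto
  finally show ?thesis .
qed

text \<open>The top part of the profile has one vertex per transversal pair, so the length depends
  on the profile only through intersection sizes.\<close>

lemma output_length_profile:
  assumes X: "X \<in> planar_rook_diagrams n"
  defines "C \<equiv> profile n (transversals X)"
  shows "real (output_length n X) = 4 * (real n - real (card (C \<inter> Top ` {1..n})))
     + (\<Sum>j\<le>n. \<bar>real (card (C \<inter> vertices j)) - real j\<bar>)"
proof -
  note R = transversals_order_matching[OF X]
  have "C \<inter> Top ` {1..n} = Top ` Domain (transversals X)"
    unfolding C_def profile_def using order_matchings_bounds[OF R] by auto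
  hence "card (C \<inter> Top ` {1..n}) = card (transversals X)"
    using card_Domain_order_matching[OF R, of "\<lambda>_. True"] by (simp add: card_image inj_on_def)
  thus ?thesis
    unfolding output_length_eq[OF X] sum_displacement[OF R] C_def by simp
qed

lemma bij_betw_planar_rook_subsets:
  "bij_betw (\<lambda>X. profile n (transversals X)) (planar_rook_diagrams n)
     {C. C \<subseteq> vertices n \<and> card C = n}"
  using bij_betw_trans[OF bij_betw_transversals bij_betw_profile] by (simp add: comp_def)

lemma card_planar_rook_diagrams: "card (planar_rook_diagrams n) = (2 * n choose n)"
  using bij_betw_same_card[OF bij_betw_planar_rook_subsets]
  by (simp add: n_subsets card_vertices)

text \<open>Over the \<open>n\<close>-subsets, the dots contribute through the mean
  \<open>n / 2\<close> of the top part, and the cut at \<open>j\<close> contributes a hypergeometric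
  mean absolute deviation; the cuts together form the doubly weighted convolution divided by
  \<open>n\<close>.\<close>

lemma sum_output_length:
  assumes n: "n > 0"
  shows "(\<Sum>X\<in>planar_rook_diagrams n. real (output_length n X))
     = 2 * real n * real (2 * n choose n) + (real n - 1) * 4 ^ n / 8"
proof -
  let ?S = "{C. C \<subseteq> vertices n \<and> card C = n}"
  let ?w = "\<lambda>e. real (n choose e) * real (n choose (n - e))"
  have "(\<Sum>X\<in>planar_rook_diagrams n. real (output_length n X))
      = (\<Sum>C\<in>?S. 4 * (real n - real (card (C \<inter> Top ` {1..n})))
         + (\<Sum>j\<le>n. \<bar>real (card (C \<inter> vertices j)) - real j\<bar>))"
    by (subst sum.reindex_bij_betw[OF bij_betw_planar_rook_subsets, symmetric])
       (intro sum.cong refl output_length_profile)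
  also have "\<dots> = (\<Sum>C\<in>?S. 4 * (real n - real (card (C \<inter> Top ` {1..n}))))
      + (\<Sum>j\<le>n. \<Sum>C\<in>?S. \<bar>real (card (C \<inter> vertices j)) - real j\<bar>)"
    unfolding sum.distrib by (intro arg_cong2[where f = "(+)"] refl sum.swap)
  also have "(\<Sum>C\<in>?S. 4 * (real n - real (card (C \<inter> Top ` {1..n}))))
      = 2 * real n * real (2 * n choose n)"
  proof -
    have "Top ` {1..n} \<subseteq> vertices n" by (auto simp: vertices_def)
    moreover have "vertices n - Top ` {1..n} = Bot ` {1..n}" by (auto simp: vertices_def)
    ultimately have eq: "(\<Sum>C\<in>?S. 4 * (real n - real (card (C \<inter> Top ` {1..n}))))
        = (\<Sum>e\<le>n. 4 * (real n - real e) * ?w e)"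
      using sum_subsets_split[of "vertices n" "Top ` {1..n}" "\<lambda>e. 4 * (real n - real e)" n]
      by (simp add: card_image inj_on_def)
    \<comment> \<open>Multiplication by \<open>n\<close> exposes the centred coefficient for
      \<open>p = q = r = n\<close>:
      \<open>4 * n * (n - e) = 2 * n * n + 2 * (n * n - (n + n) * e)\<close>.\<close>
    have "real n * (\<Sum>e\<le>n. 4 * (real n - real e) * ?w e) = (\<Sum>e\<le>n. 2 * real n * real n * ?w e
        + 2 * ((real n * real n - (real n + real n) * real e) * ?w e))"
      unfolding sum_distrib_left by (intro sum.cong refl) algebra
    also have "\<dots> = 2 * real n * real n * (\<Sum>e\<le>n. ?w e)"
      unfolding sum.distrib sum_distrib_left[symmetric] hypergeometric_centred_sum by simp
    also have "(\<Sum>e\<le>n. ?w e) = real (2 * n choose n)"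
      unfolding of_nat_mult[symmetric] of_nat_sum[symmetric] vandermonde by (simp only: mult_2)
    finally have "real n * (\<Sum>e\<le>n. 4 * (real n - real e) * ?w e)
        = real n * (2 * real n * real (2 * n choose n))"
      by (simp only: mult_ac)
    thus ?thesis unfolding eq using n by (simp only: mult_cancel_left of_nat_eq_0_iff) simp
  qed
  also have "(\<Sum>j\<le>n. \<Sum>C\<in>?S. \<bar>real (card (C \<inter> vertices j)) - real j\<bar>)
      = (\<Sum>j\<le>n. real j * central_binomial j * (real (n - j) * central_binomial (n - j)) / real n)"
  proof (intro sum.cong refl)
    fix j assume "j \<in> {..n}"
    hence j: "j \<le> n" by simp
    hence sub: "vertices j \<subseteq> vertices n" by (auto simp: vertices_def)
    hence "card (vertices n - vertices j) = 2 * (n - j)"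
      by (simp add: card_Diff_subset card_vertices diff_mult_distrib2)
    hence "(\<Sum>C\<in>?S. \<bar>real (card (C \<inter> vertices j)) - real j\<bar>)
        = (\<Sum>e\<le>n. \<bar>real e - real j\<bar> * (real (2 * j choose e) * real (2 * (n - j) choose (n - e))))"
      using sum_subsets_split[OF finite_vertices sub, of "\<lambda>e. \<bar>real e - real j\<bar>" n]
      by (simp add: card_vertices)
    thus "(\<Sum>C\<in>?S. \<bar>real (card (C \<inter> vertices j)) - real j\<bar>)
        = real j * central_binomial j * (real (n - j) * central_binomial (n - j)) / real n"
      using hypergeometric_central_moment[OF j n] by simp
  qed
  also have "\<dots> = (real n - 1) * 4 ^ n / 8"
    unfolding sum_divide_distrib[symmetric] central_binomial_convolution_weighted_both
    using n by simp
  finally show ?thesis .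
qed

section \<open>Averages and asymptotics\<close>

lemma average_length_eq:
  assumes "n > 0"
  shows "average_length n = 2 * real n + (4 ^ n / central_binomial n) * (real n - 1) / 8"
proof -
  have "real (2 * n choose n) > 0" by simp
  thus ?thesis
    unfolding average_length_def pRo_def
    by (simp add: card_planar_rook_diagrams sum_output_length[OF assms] central_binomial_def
      field_simps)
qed

lemma average_runtime_eq: "average_runtime n = 2 * real n + 2 * average_length n"
proof -
  have "real (2 * n choose n) > 0" by simp
  thus ?thesis
    unfolding average_runtime_def average_length_def step_count_def pRo_def
    by (simp add: card_planar_rook_diagrams sum.distrib sum_distrib_left[symmetric] field_simps)
qed

text \<open>By the Wallis bounds the second term of the closed form behaves like
  \<open>sqrt (pi * n) * n / 4\<close>, which dominates the linear term.\<close>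

lemma average_runtime_asymp:
  "average_runtime \<sim>[at_top] (\<lambda>n. sqrt pi / 4 * real n powr (3 / 2))"
proof -
  let ?g = "\<lambda>n. sqrt pi / 4 * real n powr (3 / 2)"
  have "(\<lambda>n. (4 ^ n / central_binomial n) * ((real n - 1) / 4))
      \<sim>[at_top] (\<lambda>n. sqrt (pi * real n) * (real n / 4))"
    by (intro asymp_equiv_mult central_binomial_asymp) real_asymp
  also have "(\<lambda>n. sqrt (pi * real n) * (real n / 4)) = ?g"
  proof
    fix n :: nat
    have "real n powr (3 / 2) = real n * sqrt (real n)"
      using powr_add[of "real n" 1 "1 / 2"] by (simp add: powr_half_sqrt)
    thus "sqrt (pi * real n) * (real n / 4) = ?g n" by (simp add: real_sqrt_mult)
  qed
  finally have main: "(\<lambda>n. (4 ^ n / central_binomial n) * ((real n - 1) / 4)) \<sim>[at_top] ?g" .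
  have "(\<lambda>n. 6 * real n) \<in> o(?g)"
    by real_asymp
  hence "(\<lambda>n. 6 * real n + (4 ^ n / central_binomial n) * ((real n - 1) / 4)) \<sim>[at_top] ?g"
    using main by (simp only: asymp_equiv_add_left)
  moreover have "\<forall>\<^sub>F n in at_top.
      6 * real n + (4 ^ n / central_binomial n) * ((real n - 1) / 4) = average_runtime n"
    using eventually_gt_at_top[of 0]
    by eventually_elim (simp add: average_runtime_eq average_length_eq mult_ac)
  ultimately show ?thesis
    by (rule asymp_equiv_transfer) simp
qed

theorem proposition3p2p5:
  shows "(\<forall>n::nat. n \<ge> 2 \<longrightarrow>
            average_length n =
              2 * real n + 2 ^ (2 * n - 3) * (real n - 1) / real ((2 * n) choose n) \<and>
            average_runtime n =
              6 * real n + 2 ^ (2 * n - 2) * (real n - 1) / real ((2 * n) choose n)) \<and>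
         average_runtime \<sim>[at_top] (\<lambda>n. sqrt pi / 4 * real n powr (3 / 2))"
proof (intro conjI allI impI average_runtime_asymp)
  fix n :: nat assume n: "n \<ge> 2"
  \<comment> \<open>The substitution resolves the truncated subtractions in the exponents
    \<open>2 * n - 3\<close> and \<open>2 * n - 2\<close>.\<close>
  obtain m where m: "n = m + 2" using n by (metis le_add_diff_inverse2)
  have "(4::real) ^ m = 2 ^ (2 * m)" by (simp add: power_mult)
  hence pow: "(4::real) ^ n = 8 * 2 ^ (2 * n - 3)" "(4::real) ^ n = 4 * 2 ^ (2 * n - 2)"
    by (simp_all add: m power_add)
  show "average_length n
      = 2 * real n + 2 ^ (2 * n - 3) * (real n - 1) / real ((2 * n) choose n)"
    using n by (simp add: average_length_eq central_binomial_def pow(1))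
  show "average_runtime n
      = 6 * real n + 2 ^ (2 * n - 2) * (real n - 1) / real ((2 * n) choose n)"
    using n by (simp add: average_runtime_eq average_length_eq central_binomial_def pow(2))
qed

end
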